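(* Let $\boldsymbol{f},\epsilon,\rho_0,\rho_1$ be given, and let $(\rho^{\rm opt},\psi)$ satisfy the system of nonlinear PDEs $$\frac{\partial\psi}{\partial t}+\frac12\|\boldsymbol{B}(t)^{\top}\nabla\psi\|_2^2+\langle\nabla\psi,\boldsymbol{f}\rangle=-\epsilon\langle\boldsymbol{D}(t),\mathbf{Hess}(\psi)\rangle,$$ $$\frac{\partial}{\partial t}\rho^{\rm opt}+\nabla\cdot\big(\rho^{\rm opt}(\boldsymbol{f}+\boldsymbol{B}(t)\boldsymbol{B}(t)^{\top}\nabla\psi)\big)=\epsilon\langle\boldsymbol{D}(t),\mathbf{Hess}(\rho^{\rm opt})\rangle,$$ with boundary conditions $\rho^{\rm opt}(\boldsymbol{x},0)=\rho_0(\boldsymbol{x})$, $\rho^{\rm opt}(\boldsymbol{x},1)=\rho_1(\boldsymbol{x})$, these being the first order optimality conditions (with optimal control $\boldsymbol{u}^{\rm opt}=\boldsymbol{B}(t)^{\top}\nabla\psi$) of the density steering problem (P) in the context. Consider the Hopf-Cole transform $(\rho^{\rm opt},\psi)\mapsto(\varphi,\hat\varphi)$ given by $$\varphi(\boldsymbol{x},t)=\exp\left(\frac{\psi(\boldsymbol{x},t)}{2\epsilon}\right),\qquad \hat\varphi(\boldsymbol{x},t)=\rho^{\rm opt}(\boldsymbol{x},t)\exp\left(-\frac{\psi(\boldsymbol{x},t)}{2\epsilon}\right).$$ Then $(\varphi,\hat\varphi)$ satisfies the system of linear PDEs $$\frac{\partial\varphi}{\partial t}=-\langle\nabla\varphi,\boldsymbol{f}\rangle-\epsilon\langle\boldsymbol{D}(t),\mathbf{Hess}(\varphi)\rangle,\qquad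 \frac{\partial\hat\varphi}{\partial t}=-\nabla\cdot(\hat\varphi\boldsymbol{f})+\epsilon\langle\boldsymbol{D}(t),\mathbf{Hess}(\hat\varphi)\rangle,$$ with boundary conditions $$\varphi(\boldsymbol{x},0)\hat\varphi(\boldsymbol{x},0)=\rho_0(\boldsymbol{x}),\qquad \varphi(\boldsymbol{x},1)\hat\varphi(\boldsymbol{x},1)=\rho_1(\boldsymbol{x}).$$ Moreover, the optimal controlled state PDF solving (P) is $\rho^{\rm opt}(\boldsymbol{x},t)=\varphi(\boldsymbol{x},t)\hat\varphi(\boldsymbol{x},t)$, and the optimal control for (P) is $$\boldsymbol{u}^{\rm opt}(\boldsymbol{x},t)=2\epsilon\,\boldsymbol{B}(t)^{\top}\nabla\log\varphi(\boldsymbol{x},t).$$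
   Context: Setting: $\epsilon>0$; $\boldsymbol{f}(\boldsymbol{x},t)\in\mathbb{R}^n$ is a given deterministic vector field, $\boldsymbol{x}\in\mathbb{R}^n$, $t\in[0,1]$; $\boldsymbol{B}(t)\in\mathbb{R}^{n\times m}$; $\boldsymbol{D}(t):=\boldsymbol{B}(t)\boldsymbol{B}(t)^{\top}$; $\rho_0,\rho_1$ are prescribed probability density functions (PDFs) on $\mathbb{R}^n$. Standing assumptions: (i) there exist constants $c_1,c_2$ with $\|\boldsymbol{f}(\boldsymbol{x},t)\|_2+\|\boldsymbol{B}(t)\|_2\le c_1(1+\|\boldsymbol{x}\|_2)$ and $\|\boldsymbol{f}(\boldsymbol{x},t)-\boldsymbol{f}(\boldsymbol{y},t)\|_2\le c_2\|\boldsymbol{x}-\boldsymbol{y}\|_2$ for all $\boldsymbol{x},\boldsymbol{y}\in\mathbb{R}^n$, $t\in[0,1]$; (ii) there exists a constant $c_3>0$ with $\langle\boldsymbol{x},\boldsymbol{D}(t)\boldsymbol{x}\rangle\ge c_3\|\boldsymbol{x}\|_2^2$ for all $\boldsymbol{x}\in\mathbb{R}^n$, $t\in[0,1]$. Problem (P): minimize $\frac12\int_0^1\int_{\mathbb{R}^n}\|\boldsymbol{u}(\boldsymbol{x},t)\|_2^2\,\rho(\boldsymbol{x},t)\,d\boldsymbol{x}\,dt$ over pairs $(\rho,\boldsymbol{u})\in\mathcal{P}(\mathbb{R}^n)\times\mathcal{U}$ subject to $\frac{\partial\rho}{\partial t}+\nabla\cdot(\rho(\boldsymbol{f}+\boldsymbol{B}(t)\boldsymbol{u}))=\epsilon\langle\boldsymbol{D}(t),\mathbf{Hess}(\rho)\rangle$,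 $\rho(\boldsymbol{x},0)=\rho_0(\boldsymbol{x})$, $\rho(\boldsymbol{x},1)=\rho_1(\boldsymbol{x})$. Here $\mathcal{P}(\mathbb{R}^n)$ is the collection of joint PDFs on $\mathbb{R}^n$ ($\rho(\cdot,t)\in\mathcal{P}(\mathbb{R}^n)$ for each $t$), and $\mathcal{U}$ is the set of finite energy inputs $\boldsymbol{u}:\mathbb{R}^n\times[0,1]\to\mathbb{R}^m$, $\langle\boldsymbol{u},\boldsymbol{u}\rangle<\infty$. The pair $(\rho^{\rm opt},\boldsymbol{u}^{\rm opt})$ denotes the solution of (P), and $\psi(\boldsymbol{x},t)$ is the scalar Lagrange multiplier for the PDE constraint, with $\boldsymbol{u}^{\rm opt}=\boldsymbol{B}(t)^{\top}\nabla\psi$. $\nabla$, $\nabla\cdot$ and $\mathbf{Hess}$ are the Euclidean gradient, divergence and Hessian with respect to $\boldsymbol{x}$. For vectors $\langle\boldsymbol{a},\boldsymbol{b}\rangle=\boldsymbol{a}^{\top}\boldsymbol{b}$; for matrices $\langle\boldsymbol{A},\boldsymbol{C}\rangle=\mathrm{trace}(\boldsymbol{A}^{\top}\boldsymbol{C})$; $\|\cdot\|_2$ is the Euclidean norm of vectors and the spectral norm of matrices. Smoothness is understood to be such that the derivatives appearing make sense. *)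

theory Defs
  imports "HOL-Analysis.Analysis"
begin

section \<open>Vector calculus on Euclidean space\<close>

definition grad :: "(real^'n \<Rightarrow> real) \<Rightarrow> real^'n \<Rightarrow> real^'n" where
  "grad g x = (THE D. GDERIV g x :> D)"

definition divg :: "(real^'n \<Rightarrow> real^'n) \<Rightarrow> real^'n \<Rightarrow> real" where
  "divg F x = trace (jacobian F (at x))"

definition hess :: "(real^'n \<Rightarrow> real) \<Rightarrow> real^'n \<Rightarrow> real^'n^'n" where
  "hess g x = jacobian (grad g) (at x)"

definition frob :: "real^'m^'n \<Rightarrow> real^'m^'n \<Rightarrow> real" where
  "frob A C = trace (transpose A ** C)"

text \<open>
  All functions of space and time are total on \<open>real^'n \<times> real\<close>; only their values for times
  in \<open>{0..1}\<close> are meaningful. Differential equations are imposed at the interior times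
  \<open>{0<..<1}\<close>, so the prescribed densities at times 0 and 1 need not be differentiable.
  The next predicate says that \<open>\<partial>w/\<partial>t\<close>, \<open>\<nabla>w\<close> and \<open>Hess w\<close> exist there.
\<close>

definition diff_1_2 :: "(real^'n \<Rightarrow> real \<Rightarrow> real) \<Rightarrow> bool" where
  "diff_1_2 w \<longleftrightarrow> (\<forall>x. \<forall>t\<in>{0<..<1}.
     (\<lambda>s. w x s) differentiable (at t) \<and>
     (\<lambda>y. w y t) differentiable (at x) \<and>
     grad (\<lambda>y. w y t) differentiable (at x))"

definition space_diff :: "(real^'n \<Rightarrow> real \<Rightarrow> real^'n) \<Rightarrow> bool" where
  "space_diff F \<longleftrightarrow> (\<forall>x. \<forall>t\<in>{0<..<1}. (\<lambda>y. F y t) differentiable (at x))"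

section \<open>The data\<close>

definition diffusion :: "(real \<Rightarrow> real^'m^'n) \<Rightarrow> real \<Rightarrow> real^'n^'n" where
  "diffusion B t = B t ** transpose (B t)"

text \<open>The spectral norm of a matrix is the operator norm of the induced linear map;
  \<open>norm\<close> on \<open>real^'m^'n\<close> is the Frobenius norm instead.\<close>

definition growth_lipschitz :: "(real^'n \<Rightarrow> real \<Rightarrow> real^'n) \<Rightarrow> (real \<Rightarrow> real^'m^'n) \<Rightarrow> bool" where
  "growth_lipschitz f B \<longleftrightarrow> (\<exists>c1 c2. \<forall>x y. \<forall>t\<in>{0..1}.
     norm (f x t) + onorm ((*v) (B t)) \<le> c1 * (1 + norm x) \<and>
     norm (f x t - f y t) \<le> c2 * norm (x - y))"

definition uniformly_elliptic :: "(real \<Rightarrow> real^'m^'n) \<Rightarrow> bool" where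
  "uniformly_elliptic B \<longleftrightarrow> (\<exists>c3>0. \<forall>x. \<forall>t\<in>{0..1}.
     x \<bullet> (diffusion B t *v x) \<ge> c3 * (norm x)\<^sup>2)"

definition is_pdf :: "(real^'n \<Rightarrow> real) \<Rightarrow> bool" where
  "is_pdf p \<longleftrightarrow> p \<in> borel_measurable borel \<and> (\<forall>x. p x \<ge> 0) \<and>
     (\<integral>\<^sup>+ x. ennreal (p x) \<partial>lborel) = 1"

section \<open>The density steering problem\<close>

definition energy :: "(real^'n \<Rightarrow> real \<Rightarrow> real) \<Rightarrow> (real^'n \<Rightarrow> real \<Rightarrow> real^'m) \<Rightarrow> ennreal" where
  "energy \<rho> u =
     (\<integral>\<^sup>+ t\<in>{0..1}. (\<integral>\<^sup>+ x. ennreal ((norm (u x t))\<^sup>2 * \<rho> x t) \<partial>lborel) \<partial>lborel)"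

definition cost :: "(real^'n \<Rightarrow> real \<Rightarrow> real) \<Rightarrow> (real^'n \<Rightarrow> real \<Rightarrow> real^'m) \<Rightarrow> ennreal" where
  "cost \<rho> u = ennreal (1/2) * energy \<rho> u"

definition finite_energy :: "(real^'n \<Rightarrow> real \<Rightarrow> real) \<Rightarrow> (real^'n \<Rightarrow> real \<Rightarrow> real^'m) \<Rightarrow> bool" where
  "finite_energy \<rho> u \<longleftrightarrow>
     set_borel_measurable borel (UNIV \<times> {0<..<1}) (\<lambda>(x, t). u x t) \<and> energy \<rho> u < \<infinity>"

definition controlled_FPK ::
  "real \<Rightarrow> (real^'n \<Rightarrow> real \<Rightarrow> real^'n) \<Rightarrow> (real \<Rightarrow> real^'m^'n) \<Rightarrow>
   (real^'n \<Rightarrow> real \<Rightarrow> real) \<Rightarrow> (real^'n \<Rightarrow> real \<Rightarrow> real^'m) \<Rightarrow> bool" where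
  "controlled_FPK \<epsilon> f B \<rho> u \<longleftrightarrow>
     diff_1_2 \<rho> \<and> space_diff (\<lambda>x t. \<rho> x t *\<^sub>R (f x t + B t *v u x t)) \<and>
     (\<forall>x. \<forall>t\<in>{0<..<1}.
        deriv (\<lambda>s. \<rho> x s) t + divg (\<lambda>y. \<rho> y t *\<^sub>R (f y t + B t *v u y t)) x
        = \<epsilon> * frob (diffusion B t) (hess (\<lambda>y. \<rho> y t) x))"

text \<open>The equation only constrains interior times, so continuity of \<open>t \<mapsto> \<rho>(\<cdot>,t)\<close> in \<open>L\<^sup>1\<close>
  on the closed interval is what ties it to the prescribed densities at times 0 and 1.\<close>

definition L1_continuous :: "(real^'n \<Rightarrow> real \<Rightarrow> real) \<Rightarrow> bool" where
  "L1_continuous \<rho> \<longleftrightarrow> (\<forall>s\<in>{0..1}.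
     ((\<lambda>t. \<integral>\<^sup>+ x. ennreal \<bar>\<rho> x t - \<rho> x s\<bar> \<partial>lborel) \<longlongrightarrow> 0) (at s within {0..1}))"

definition feasible ::
  "real \<Rightarrow> (real^'n \<Rightarrow> real \<Rightarrow> real^'n) \<Rightarrow> (real \<Rightarrow> real^'m^'n) \<Rightarrow>
   (real^'n \<Rightarrow> real) \<Rightarrow> (real^'n \<Rightarrow> real) \<Rightarrow>
   (real^'n \<Rightarrow> real \<Rightarrow> real) \<Rightarrow> (real^'n \<Rightarrow> real \<Rightarrow> real^'m) \<Rightarrow> bool" where
  "feasible \<epsilon> f B \<rho>0 \<rho>1 \<rho> u \<longleftrightarrow>
     (\<forall>t\<in>{0..1}. is_pdf (\<lambda>x. \<rho> x t)) \<and> L1_continuous \<rho> \<and> finite_energy \<rho> u \<and>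
     controlled_FPK \<epsilon> f B \<rho> u \<and>
     (\<forall>x. \<rho> x 0 = \<rho>0 x) \<and> (\<forall>x. \<rho> x 1 = \<rho>1 x)"

definition solves_steering ::
  "real \<Rightarrow> (real^'n \<Rightarrow> real \<Rightarrow> real^'n) \<Rightarrow> (real \<Rightarrow> real^'m^'n) \<Rightarrow>
   (real^'n \<Rightarrow> real) \<Rightarrow> (real^'n \<Rightarrow> real) \<Rightarrow>
   (real^'n \<Rightarrow> real \<Rightarrow> real) \<Rightarrow> (real^'n \<Rightarrow> real \<Rightarrow> real^'m) \<Rightarrow> bool" where
  "solves_steering \<epsilon> f B \<rho>0 \<rho>1 \<rho> u \<longleftrightarrow>
     feasible \<epsilon> f B \<rho>0 \<rho>1 \<rho> u \<and>
     (\<forall>\<rho>' u'. feasible \<epsilon> f B \<rho>0 \<rho>1 \<rho>' u' \<longrightarrow> cost \<rho> u \<le> cost \<rho>' u')"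

end

theory Submission
  imports Defs
begin

text \<open>
  Write \<open>k = 1/(2\<epsilon>)\<close>, so that \<open>\<phi> = exp (k \<psi>)\<close> and \<open>\<phi>h = \<rho> exp (- k \<psi>)\<close>. The chain rule gives
  \<open>\<nabla>\<phi> = k \<phi> \<nabla>\<psi>\<close> and \<open>Hess \<phi> = k \<phi> (Hess \<psi> + k \<nabla>\<psi> \<nabla>\<psi>\<^sup>T)\<close>
  (lemmas \<open>grad_exp\<close> and \<open>hess_exp\<close>). Relative to the common factor \<open>k \<phi>\<close>, the quadratic
  term \<open>k \<langle>\<nabla>\<psi>, D \<nabla>\<psi>\<rangle>\<close>, multiplied by
  \<open>\<epsilon>\<close>, is exactly the nonlinearity \<open>\<bar>B\<^sup>T \<nabla>\<psi>\<bar>\<^sup>2 / 2\<close> of the Hamilton-Jacobi-Bellman equation,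
  which is why that equation becomes linear in \<open>\<phi>\<close> (lemma \<open>hopf_cole_backward\<close>).

  For \<open>\<phi>h\<close>, the product rules for the divergence and for the Hessian (\<open>divg_scaleR\<close>,
  \<open>hess_mult\<close>) expand both sides of the forward equation. The cross term
  \<open>2 \<epsilon> \<langle>\<nabla>\<rho>, D \<nabla>exp (- k \<psi>)\<rangle>\<close> of the Hessian equals \<open>- exp (- k \<psi>) \<langle>\<nabla>\<rho>, D \<nabla>\<psi>\<rangle>\<close>,
  which is the contribution of the optimal drift \<open>D \<nabla>\<psi>\<close> acting on \<open>\<nabla>\<rho>\<close>, and the
  remaining terms in \<open>Hess \<psi>\<close> and \<open>\<langle>\<nabla>\<psi>, D \<nabla>\<psi>\<rangle>\<close> are absorbed by the
  Hamilton-Jacobi-Bellman equation (lemma \<open>hopf_cole_forward\<close>). Only the symmetry of \<open>D\<close> is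
  needed here, never that of a Hessian.

  Finally \<open>\<phi> \<phi>h = \<rho>\<close> at all times, while \<open>2 \<epsilon> B\<^sup>T \<nabla>ln \<phi> = B\<^sup>T \<nabla>\<psi>\<close> agrees with the optimal control
  at the interior times. The steering problem does not see the values of a control at the
  times 0 and 1 (lemma \<open>solves_steering_cong\<close>), so optimality carries over.
\<close>

section \<open>Gradients, Jacobians and divergences\<close>

lemma grad_eqI:
  assumes "GDERIV g x :> D"
  shows "grad g x = D"
  unfolding grad_def
proof (rule the_equality)
  fix D' assume "GDERIV g x :> D'"
  then have "(\<lambda>h. h \<bullet> D') = (\<lambda>h. h \<bullet> D)"
    using assms unfolding gderiv_def by (rule has_derivative_unique)
  then show "D' = D"
    by (metis vector_eq_ldot)
qed (fact assms)

lemma GDERIV_grad: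
  fixes g :: "real^'n \<Rightarrow> real"
  assumes "g differentiable (at x)"
  shows "GDERIV g x :> grad g x"
proof -
  obtain g' where g': "(g has_derivative g') (at x)"
    using assms unfolding differentiable_def by blast
  then have "bounded_linear g'"
    by (rule has_derivative_bounded_linear)
  then have lin: "linear g'"
    by (rule bounded_linear.linear)
  \<comment> \<open>the gradient is the Riesz representative of the derivative\<close>
  have "g' = (\<lambda>h. h \<bullet> adjoint g' 1)"
    using adjoint_works[OF lin, of _ 1] by (simp add: fun_eq_iff)
  then have "GDERIV g x :> adjoint g' 1"
    unfolding gderiv_def using g' by simp
  then show ?thesis
    using grad_eqI by metis
qed

lemma GDERIV_imp_differentiable: "GDERIV g x :> D \<Longrightarrow> g differentiable (at x)"
  unfolding gderiv_def differentiable_def by blast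

lemma GDERIV_exp:
  fixes g :: "real^'n \<Rightarrow> real"
  assumes "g differentiable (at x)"
  shows "GDERIV (\<lambda>y. exp (k * g y)) x :> (k * exp (k * g x)) *\<^sub>R grad g x"
proof -
  have "DERIV (\<lambda>r. exp (k * r)) (g x) :> k * exp (k * g x)"
    by (auto intro!: derivative_eq_intros)
  from GDERIV_DERIV_compose[OF GDERIV_grad[OF assms] this] show ?thesis .
qed

lemma grad_exp:
  fixes g :: "real^'n \<Rightarrow> real"
  assumes "g differentiable (at x)"
  shows "grad (\<lambda>y. exp (k * g y)) x = (k * exp (k * g x)) *\<^sub>R grad g x"
  using grad_eqI[OF GDERIV_exp[OF assms]] .

lemma GDERIV_mult_grad:
  fixes a b :: "real^'n \<Rightarrow> real"
  assumes "a differentiable (at x)" "b differentiable (at x)"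
  shows "GDERIV (\<lambda>y. a y * b y) x :> a x *\<^sub>R grad b x + b x *\<^sub>R grad a x"
  using GDERIV_mult[OF GDERIV_grad[OF assms(1)] GDERIV_grad[OF assms(2)]] .

lemma grad_mult:
  fixes a b :: "real^'n \<Rightarrow> real"
  assumes "a differentiable (at x)" "b differentiable (at x)"
  shows "grad (\<lambda>y. a y * b y) x = a x *\<^sub>R grad b x + b x *\<^sub>R grad a x"
  using grad_eqI[OF GDERIV_mult_grad[OF assms]] .

lemma jacobian_eqI:
  fixes F :: "real^'n \<Rightarrow> real^'m"
  assumes "(F has_derivative (\<lambda>h. A *v h)) (at x)"
  shows "jacobian F (at x) = A"
  unfolding jacobian_def frechet_derivative_at[OF assms, symmetric] by simp

lemma has_derivative_jacobian:
  fixes F :: "real^'n \<Rightarrow> real^'m"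
  assumes "F differentiable (at x)"
  shows "(F has_derivative (\<lambda>h. jacobian F (at x) *v h)) (at x)"
  using assms jacobian_works by blast

text \<open>The rank one matrix \<open>a b\<^sup>T\<close>.\<close>

definition outer_prod :: "real^'n \<Rightarrow> real^'m \<Rightarrow> real^'m^'n" where
  "outer_prod a b = (\<chi> i j. a $ i * b $ j)"

lemma outer_prod_mult_vec: "outer_prod a b *v h = (b \<bullet> h) *\<^sub>R a"
  by (simp add: vec_eq_iff outer_prod_def matrix_vector_mult_def inner_vec_def
      sum_distrib_left algebra_simps)

lemma trace_scaleR: "trace (c *\<^sub>R A) = c * trace (A :: real^'n^'n)"
  by (simp add: trace_def sum_distrib_left)

lemma trace_outer_prod: "trace (outer_prod a b) = a \<bullet> b"
  by (simp add: trace_def outer_prod_def inner_vec_def)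

lemma jacobian_scaleR:
  fixes F :: "real^'n \<Rightarrow> real^'m"
  assumes "g differentiable (at x)" "F differentiable (at x)"
  shows "jacobian (\<lambda>y. g y *\<^sub>R F y) (at x)
    = g x *\<^sub>R jacobian F (at x) + outer_prod (F x) (grad g x)"
proof (rule jacobian_eqI)
  have "(g has_derivative (\<lambda>h. h \<bullet> grad g x)) (at x)"
    using GDERIV_grad[OF assms(1)] unfolding gderiv_def .
  note has_derivative_scaleR[OF this has_derivative_jacobian[OF assms(2)]]
  moreover have "(\<lambda>h. g x *\<^sub>R (jacobian F (at x) *v h) + (h \<bullet> grad g x) *\<^sub>R F x)
      = (*v) (g x *\<^sub>R jacobian F (at x) + outer_prod (F x) (grad g x))"
    by (simp add: fun_eq_iff matrix_vector_mult_add_rdistrib outer_prod_mult_vec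
        scaleR_matrix_vector_assoc inner_commute)
  ultimately show "((\<lambda>y. g y *\<^sub>R F y) has_derivative
      (*v) (g x *\<^sub>R jacobian F (at x) + outer_prod (F x) (grad g x))) (at x)"
    by simp
qed

lemma jacobian_add:
  fixes F G :: "real^'n \<Rightarrow> real^'m"
  assumes "F differentiable (at x)" "G differentiable (at x)"
  shows "jacobian (\<lambda>y. F y + G y) (at x) = jacobian F (at x) + jacobian G (at x)"
  using has_derivative_add[OF has_derivative_jacobian[OF assms(1)]
      has_derivative_jacobian[OF assms(2)]]
  by (intro jacobian_eqI) (simp add: matrix_vector_mult_add_rdistrib)

lemma has_derivative_matrix_vector:
  fixes F :: "real^'n \<Rightarrow> real^'m" and M :: "real^'m^'k"
  assumes "F differentiable (at x)"
  shows "((\<lambda>y. M *v F y) has_derivative (\<lambda>h. (M ** jacobian F (at x)) *v h)) (at x)"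
  using bounded_linear.has_derivative[OF matrix_vector_mul_bounded_linear
      has_derivative_jacobian[OF assms], of M]
  by (simp add: matrix_vector_mul_assoc)

lemma differentiable_matrix_vector:
  fixes F :: "real^'n \<Rightarrow> real^'m" and M :: "real^'m^'k"
  assumes "F differentiable (at x)"
  shows "(\<lambda>y. M *v F y) differentiable (at x)"
  using has_derivative_matrix_vector[OF assms] unfolding differentiable_def by blast

lemma divg_scaleR:
  assumes "g differentiable (at x)" "F differentiable (at x)"
  shows "divg (\<lambda>y. g y *\<^sub>R F y) x = g x * divg F x + grad g x \<bullet> F x"
  unfolding divg_def jacobian_scaleR[OF assms]
  by (simp add: trace_add trace_scaleR trace_outer_prod inner_commute)

lemma divg_add:
  assumes "F differentiable (at x)" "G differentiable (at x)"
  shows "divg (\<lambda>y. F y + G y) x = divg F x + divg G x"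
  unfolding divg_def jacobian_add[OF assms] by (rule trace_add)

lemma divg_matrix_grad:
  fixes M :: "real^'n^'n"
  assumes "grad g differentiable (at x)"
  shows "divg (\<lambda>y. M *v grad g y) x = frob (transpose M) (hess g x)"
  unfolding divg_def frob_def hess_def jacobian_eqI[OF has_derivative_matrix_vector[OF assms]]
  by simp

section \<open>Hessians of exponentials and products\<close>

lemma differentiable_grad_exp:
  assumes "\<And>y. g differentiable (at y)" "grad g differentiable (at x)"
  shows "grad (\<lambda>y. exp (k * g y)) differentiable (at x)"
proof -
  have e: "(\<lambda>y. exp (k * g y)) differentiable (at x)"
    using GDERIV_imp_differentiable[OF GDERIV_exp[OF assms(1)]] .
  have "(\<lambda>y. (k * exp (k * g y)) *\<^sub>R grad g y) differentiable (at x)"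
    using e assms(2) by (intro differentiable_scaleR differentiable_mult) auto
  then show ?thesis
    using grad_exp[OF assms(1)] by presburger
qed

lemma hess_exp:
  assumes "\<And>y. g differentiable (at y)" "grad g differentiable (at x)"
  shows "hess (\<lambda>y. exp (k * g y)) x
    = (k * exp (k * g x)) *\<^sub>R (hess g x + k *\<^sub>R outer_prod (grad g x) (grad g x))"
proof -
  have e: "GDERIV (\<lambda>y. k * exp (k * g y)) x :> k *\<^sub>R ((k * exp (k * g x)) *\<^sub>R grad g x)"
    using GDERIV_mult[OF GDERIV_const[of k] GDERIV_exp[OF assms(1)]] by simp
  have "grad (\<lambda>y. exp (k * g y)) = (\<lambda>y. (k * exp (k * g y)) *\<^sub>R grad g y)"
    using grad_exp[OF assms(1)] by blast
  then have "hess (\<lambda>y. exp (k * g y)) x = (k * exp (k * g x)) *\<^sub>R jacobian (grad g) (at x)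
      + outer_prod (grad g x) (k *\<^sub>R ((k * exp (k * g x)) *\<^sub>R grad g x))"
    unfolding hess_def
    by (simp add: jacobian_scaleR[OF GDERIV_imp_differentiable[OF e] assms(2)] grad_eqI[OF e])
  then show ?thesis
    by (simp add: hess_def outer_prod_def vec_eq_iff algebra_simps)
qed

lemma differentiable_grad_mult:
  assumes "\<And>y. a differentiable (at y)" "\<And>y. b differentiable (at y)"
    and "grad a differentiable (at x)" "grad b differentiable (at x)"
  shows "grad (\<lambda>y. a y * b y) differentiable (at x)"
proof -
  have "(\<lambda>y. a y *\<^sub>R grad b y + b y *\<^sub>R grad a y) differentiable (at x)"
    using assms by (intro differentiable_add differentiable_scaleR)
  then show ?thesis
    using grad_mult[OF assms(1,2)] by presburger
qed

lemma hess_mult: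
  assumes "\<And>y. a differentiable (at y)" "\<And>y. b differentiable (at y)"
    and "grad a differentiable (at x)" "grad b differentiable (at x)"
  shows "hess (\<lambda>y. a y * b y) x = a x *\<^sub>R hess b x + b x *\<^sub>R hess a x
    + outer_prod (grad b x) (grad a x) + outer_prod (grad a x) (grad b x)"
proof -
  have "grad (\<lambda>y. a y * b y) = (\<lambda>y. a y *\<^sub>R grad b y + b y *\<^sub>R grad a y)"
    using grad_mult[OF assms(1,2)] by blast
  then show ?thesis
    unfolding hess_def
    using assms
    by (simp add: jacobian_add jacobian_scaleR differentiable_scaleR algebra_simps)
qed

lemma frob_add: "frob D (A + C) = frob D A + frob D C"
  by (simp add: frob_def matrix_add_ldistrib trace_add)

lemma frob_scaleR: "frob D (c *\<^sub>R A) = c * frob D A"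
  by (simp add: frob_def trace_def matrix_matrix_mult_def sum_distrib_left algebra_simps)

lemma frob_outer_prod: "frob D (outer_prod a b) = a \<bullet> (D *v b)"
proof -
  have "frob D (outer_prod a b) = (\<Sum>i\<in>UNIV. \<Sum>k\<in>UNIV. D $ k $ i * (a $ k * b $ i))"
    by (simp add: frob_def trace_def matrix_matrix_mult_def transpose_def outer_prod_def)
  also have "\<dots> = (\<Sum>k\<in>UNIV. \<Sum>i\<in>UNIV. D $ k $ i * (a $ k * b $ i))"
    by (rule sum.swap)
  also have "\<dots> = a \<bullet> (D *v b)"
    by (simp add: inner_vec_def matrix_vector_mult_def sum_distrib_left algebra_simps)
  finally show ?thesis .
qed

lemma transpose_diffusion: "transpose (diffusion B t) = diffusion B t"
  by (simp add: diffusion_def matrix_transpose_mul)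

lemma diffusion_inner_commute: "a \<bullet> (diffusion B t *v b) = b \<bullet> (diffusion B t *v a)"
  by (metis dot_lmul_matrix inner_commute transpose_diffusion vector_transpose_matrix)

lemma norm_transpose_mult_sq:
  "(norm (transpose (B t) *v p))\<^sup>2 = p \<bullet> (diffusion B t *v p)"
proof -
  have "(transpose (B t) *v p) \<bullet> (transpose (B t) *v p) = p \<bullet> (B t *v (transpose (B t) *v p))"
    by (simp add: dot_lmul_matrix)
  then show ?thesis
    unfolding power2_norm_eq_inner diffusion_def matrix_vector_mul_assoc .
qed

lemma diff_1_2_exp:
  assumes "diff_1_2 w"
  shows "diff_1_2 (\<lambda>x t. exp (k * w x t))"
  unfolding diff_1_2_def
proof (intro allI ballI conjI)
  fix x and t :: real assume t: "t \<in> {0<..<1}"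
  have w: "(\<lambda>s. w x s) differentiable (at t)"
      "\<And>y. (\<lambda>y. w y t) differentiable (at y)" "grad (\<lambda>y. w y t) differentiable (at x)"
    using assms t unfolding diff_1_2_def by blast+
  have "DERIV (w x) t :> deriv (w x) t"
    using w(1) DERIV_deriv_iff_real_differentiable by blast
  then have "DERIV (\<lambda>s. exp (k * w x s)) t :> exp (k * w x t) * (k * deriv (w x) t)"
    by (auto intro!: derivative_eq_intros)
  then show "(\<lambda>s. exp (k * w x s)) differentiable (at t)"
    using real_differentiable_def by blast
  show "(\<lambda>y. exp (k * w y t)) differentiable (at x)"
    using GDERIV_imp_differentiable[OF GDERIV_exp[OF w(2)]] .
  show "grad (\<lambda>y. exp (k * w y t)) differentiable (at x)"
    using differentiable_grad_exp w by blast
qed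

lemma diff_1_2_mult:
  assumes "diff_1_2 v" "diff_1_2 w"
  shows "diff_1_2 (\<lambda>x t. v x t * w x t)"
  using assms unfolding diff_1_2_def
  by (auto intro!: differentiable_mult differentiable_grad_mult)

section \<open>The Hopf-Cole transform\<close>

text \<open>The Hamilton-Jacobi-Bellman equation for \<open>\<psi>\<close> turns into the backward Kolmogorov equation for
  \<open>exp (\<psi> / (2 \<epsilon>))\<close>.\<close>

lemma hopf_cole_backward:
  fixes \<psi> :: "real^'n \<Rightarrow> real \<Rightarrow> real"
  assumes \<epsilon>: "\<epsilon> > 0" and k: "k = 1 / (2 * \<epsilon>)"
    and \<psi>: "diff_1_2 \<psi>" and t: "t \<in> {0<..<1}"
    and hjb: "deriv (\<lambda>s. \<psi> x s) t
             + 1/2 * (norm (transpose (B t) *v grad (\<lambda>y. \<psi> y t) x))\<^sup>2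
             + grad (\<lambda>y. \<psi> y t) x \<bullet> v
           = - \<epsilon> * frob (diffusion B t) (hess (\<lambda>y. \<psi> y t) x)"
  shows "deriv (\<lambda>s. exp (k * \<psi> x s)) t
    = - (grad (\<lambda>y. exp (k * \<psi> y t)) x \<bullet> v)
      - \<epsilon> * frob (diffusion B t) (hess (\<lambda>y. exp (k * \<psi> y t)) x)"
proof -
  have d: "(\<lambda>s. \<psi> x s) differentiable (at t)"
      "\<And>y. (\<lambda>y. \<psi> y t) differentiable (at y)" "grad (\<lambda>y. \<psi> y t) differentiable (at x)"
    using \<psi> t unfolding diff_1_2_def by blast+
  define E where "E = exp (k * \<psi> x t)"
  define p where "p = grad (\<lambda>y. \<psi> y t) x"
  define H where "H = frob (diffusion B t) (hess (\<lambda>y. \<psi> y t) x)"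
  define q where "q = p \<bullet> (diffusion B t *v p)"
  define \<psi>t where "\<psi>t = deriv (\<lambda>s. \<psi> x s) t"
  have "DERIV (\<psi> x) t :> \<psi>t"
    unfolding \<psi>t_def using d(1) DERIV_deriv_iff_real_differentiable by blast
  then have "DERIV (\<lambda>s. exp (k * \<psi> x s)) t :> E * (k * \<psi>t)"
    unfolding E_def by (auto intro!: derivative_eq_intros)
  then have 1: "deriv (\<lambda>s. exp (k * \<psi> x s)) t = E * (k * \<psi>t)"
    by (rule DERIV_imp_deriv)
  have 2: "grad (\<lambda>y. exp (k * \<psi> y t)) x = (k * E) *\<^sub>R p"
    unfolding p_def E_def by (rule grad_exp[OF d(2)])
  have 3: "frob (diffusion B t) (hess (\<lambda>y. exp (k * \<psi> y t)) x) = k * E * (H + k * q)"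
    unfolding hess_exp[OF d(2,3)] frob_add frob_scaleR frob_outer_prod
    by (simp add: E_def H_def q_def p_def)
  have "\<psi>t = - (1/2 * q) - p \<bullet> v - \<epsilon> * H"
    using hjb unfolding norm_transpose_mult_sq p_def H_def q_def \<psi>t_def by simp
  moreover have "\<epsilon> * k = 1/2"
    using \<epsilon> k by simp
  ultimately show ?thesis
    unfolding 1 2 3 by (simp, algebra)
qed

text \<open>Differentiability of \<open>\<rho> F\<close> is extracted from that of the full flux \<open>\<rho> (F + D \<nabla>\<psi>)\<close> by
  subtracting the control part \<open>\<rho> D \<nabla>\<psi>\<close>; the drift \<open>F\<close> itself need not be differentiable
  where \<open>\<rho>\<close> vanishes.\<close>

lemma differentiable_drift_flux:
  fixes F :: "real^'n \<Rightarrow> real^'n" and M :: "real^'n^'n"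
  assumes "r differentiable (at x)" "grad g differentiable (at x)"
    and "(\<lambda>y. r y *\<^sub>R (F y + M *v grad g y)) differentiable (at x)"
  shows "(\<lambda>y. r y *\<^sub>R F y) differentiable (at x)"
proof -
  have "(\<lambda>y. r y *\<^sub>R (M *v grad g y)) differentiable (at x)"
    using assms(1,2) by (intro differentiable_scaleR differentiable_matrix_vector)
  from differentiable_diff[OF assms(3) this] show ?thesis
    by (simp add: scaleR_add_right)
qed

text \<open>Along a solution of the Hamilton-Jacobi-Bellman equation, the controlled Fokker-Planck
  equation for \<open>\<rho>\<close> turns into the uncontrolled one for \<open>\<rho> exp (- \<psi> / (2 \<epsilon>))\<close>.\<close>

lemma hopf_cole_forward:
  fixes \<psi> \<rho> :: "real^'n \<Rightarrow> real \<Rightarrow> real" and f :: "real^'n \<Rightarrow> real \<Rightarrow> real^'n"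
  assumes \<epsilon>: "\<epsilon> > 0" and k: "k = 1 / (2 * \<epsilon>)"
    and \<psi>: "diff_1_2 \<psi>" and \<rho>: "diff_1_2 \<rho>" and t: "t \<in> {0<..<1}"
    and flux: "(\<lambda>y. \<rho> y t *\<^sub>R (f y t + diffusion B t *v grad (\<lambda>z. \<psi> z t) y))
      differentiable (at x)"
    and hjb: "deriv (\<lambda>s. \<psi> x s) t
             + 1/2 * (norm (transpose (B t) *v grad (\<lambda>y. \<psi> y t) x))\<^sup>2
             + grad (\<lambda>y. \<psi> y t) x \<bullet> f x t
           = - \<epsilon> * frob (diffusion B t) (hess (\<lambda>y. \<psi> y t) x)"
    and fpk: "deriv (\<lambda>s. \<rho> x s) t
             + divg (\<lambda>y. \<rho> y t *\<^sub>R (f y t + diffusion B t *v grad (\<lambda>z. \<psi> z t) y)) x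
           = \<epsilon> * frob (diffusion B t) (hess (\<lambda>y. \<rho> y t) x)"
  shows "deriv (\<lambda>s. \<rho> x s * exp (- k * \<psi> x s)) t
    = - divg (\<lambda>y. (\<rho> y t * exp (- k * \<psi> y t)) *\<^sub>R f y t) x
      + \<epsilon> * frob (diffusion B t) (hess (\<lambda>y. \<rho> y t * exp (- k * \<psi> y t)) x)"
proof -
  have d: "(\<lambda>s. \<psi> x s) differentiable (at t)"
      "\<And>y. (\<lambda>y. \<psi> y t) differentiable (at y)" "grad (\<lambda>y. \<psi> y t) differentiable (at x)"
    using \<psi> t unfolding diff_1_2_def by blast+
  have r: "(\<lambda>s. \<rho> x s) differentiable (at t)"
      "\<And>y. (\<lambda>y. \<rho> y t) differentiable (at y)" "grad (\<lambda>y. \<rho> y t) differentiable (at x)"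
    using \<rho> t unfolding diff_1_2_def by blast+
  have e: "\<And>y. (\<lambda>y. exp (- k * \<psi> y t)) differentiable (at y)"
      "grad (\<lambda>y. exp (- k * \<psi> y t)) differentiable (at x)"
    using diff_1_2_exp[OF \<psi>, of "- k"] t unfolding diff_1_2_def by blast+
  have rf: "(\<lambda>y. \<rho> y t *\<^sub>R f y t) differentiable (at x)"
    using differentiable_drift_flux[OF r(2) d(3) flux] .
  define E where "E = exp (- k * \<psi> x t)"
  define R where "R = \<rho> x t"
  define p where "p = grad (\<lambda>y. \<psi> y t) x"
  define m where "m = grad (\<lambda>y. \<rho> y t) x"
  define H where "H = frob (diffusion B t) (hess (\<lambda>y. \<psi> y t) x)"
  define K where "K = frob (diffusion B t) (hess (\<lambda>y. \<rho> y t) x)"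
  define q where "q = p \<bullet> (diffusion B t *v p)"
  define c where "c = m \<bullet> (diffusion B t *v p)"
  define \<psi>t where "\<psi>t = deriv (\<lambda>s. \<psi> x s) t"
  define \<rho>t where "\<rho>t = deriv (\<lambda>s. \<rho> x s) t"
  define J where "J = divg (\<lambda>y. \<rho> y t *\<^sub>R f y t) x"
  have "DERIV (\<psi> x) t :> \<psi>t" "DERIV (\<rho> x) t :> \<rho>t"
    unfolding \<psi>t_def \<rho>t_def using d(1) r(1) DERIV_deriv_iff_real_differentiable by blast+
  then have "DERIV (\<lambda>s. \<rho> x s * exp (- k * \<psi> x s)) t :> \<rho>t * E - R * E * (k * \<psi>t)"
    unfolding E_def R_def by (auto intro!: derivative_eq_intros)
  then have 1: "deriv (\<lambda>s. \<rho> x s * exp (- k * \<psi> x s)) t = \<rho>t * E - R * E * (k * \<psi>t)"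
    by (rule DERIV_imp_deriv)
  have ge: "grad (\<lambda>y. exp (- k * \<psi> y t)) x = (- k * E) *\<^sub>R p"
    unfolding p_def E_def by (rule grad_exp[OF d(2)])
  \<comment> \<open>grouped as a scalar times \<open>\<rho> f\<close>, since \<open>f\<close> alone may fail to be differentiable\<close>
  have "(\<lambda>y. (\<rho> y t * exp (- k * \<psi> y t)) *\<^sub>R f y t)
      = (\<lambda>y. exp (- k * \<psi> y t) *\<^sub>R (\<rho> y t *\<^sub>R f y t))"
    by (simp add: mult.commute)
  then have 2: "divg (\<lambda>y. (\<rho> y t * exp (- k * \<psi> y t)) *\<^sub>R f y t) x
      = E * J - k * E * R * (p \<bullet> f x t)"
    using divg_scaleR[OF e(1) rf] ge by (simp add: E_def J_def R_def)
  have he: "frob (diffusion B t) (hess (\<lambda>y. exp (- k * \<psi> y t)) x) = - k * E * (H - k * q)"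
    unfolding hess_exp[OF d(2,3)] frob_add frob_scaleR frob_outer_prod
    by (simp add: E_def H_def q_def p_def)
  have 3: "frob (diffusion B t) (hess (\<lambda>y. \<rho> y t * exp (- k * \<psi> y t)) x)
      = R * (- k * E * (H - k * q)) + E * K - 2 * k * E * c"
    unfolding hess_mult[OF r(2) e(1) r(3) e(2)] frob_add frob_scaleR frob_outer_prod he ge
      matrix_vector_mult_scaleR inner_scaleR_left inner_scaleR_right m_def[symmetric]
      diffusion_inner_commute[of p B t m]
    unfolding R_def[symmetric] E_def[symmetric] K_def[symmetric] c_def[symmetric]
    by (simp add: algebra_simps)
  have "divg (\<lambda>y. \<rho> y t *\<^sub>R (f y t + diffusion B t *v grad (\<lambda>z. \<psi> z t) y)) x
      = J + divg (\<lambda>y. \<rho> y t *\<^sub>R (diffusion B t *v grad (\<lambda>z. \<psi> z t) y)) x"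
    unfolding scaleR_add_right J_def
    by (rule divg_add[OF rf differentiable_scaleR[OF r(2) differentiable_matrix_vector[OF d(3)]]])
  also have "divg (\<lambda>y. \<rho> y t *\<^sub>R (diffusion B t *v grad (\<lambda>z. \<psi> z t) y)) x = R * H + c"
    using divg_scaleR[OF r(2) differentiable_matrix_vector[OF d(3), of "diffusion B t"]]
      divg_matrix_grad[OF d(3), of "diffusion B t"]
    by (simp add: transpose_diffusion R_def H_def c_def m_def p_def)
  finally have "\<rho>t = \<epsilon> * K - J - R * H - c"
    using fpk unfolding \<rho>t_def K_def by simp
  moreover have "\<psi>t = - (1/2 * q) - p \<bullet> f x t - \<epsilon> * H"
    using hjb unfolding norm_transpose_mult_sq p_def H_def q_def \<psi>t_def by simp
  moreover have "\<epsilon> * k = 1/2"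
    using \<epsilon> k by simp
  ultimately show ?thesis
    unfolding 1 2 3 by algebra
qed

section \<open>Controls that agree at interior times\<close>

text \<open>Two controls that differ only at the times 0 and 1 have the same energy because these
  times form a null set and \<open>nn_integral\<close> respects equality almost everywhere
  without any measurability hypothesis.\<close>

lemma energy_cong:
  fixes u v :: "real^'n \<Rightarrow> real \<Rightarrow> real^'m"
  assumes "\<And>x t. t \<in> {0<..<1} \<Longrightarrow> u x t = v x t"
  shows "energy \<rho> u = energy \<rho> v"
  unfolding energy_def
proof (rule nn_integral_cong_AE)
  have "AE t in lborel. t \<noteq> (0::real)" "AE t in lborel. t \<noteq> (1::real)"
    by (rule AE_lborel_singleton)+
  then show "AE t in lborel. (\<integral>\<^sup>+ x. ennreal ((norm (u x t))\<^sup>2 * \<rho> x t) \<partial>lborel) * indicator {0..1} t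
      = (\<integral>\<^sup>+ x. ennreal ((norm (v x t))\<^sup>2 * \<rho> x t) \<partial>lborel) * indicator {0..1} t"
  proof eventually_elim
    case (elim t)
    then show ?case
      using assms[of t] by (cases "t \<in> {0<..<1}") (auto simp: indicator_def)
  qed
qed

lemma feasible_cong:
  fixes u v :: "real^'n \<Rightarrow> real \<Rightarrow> real^'m"
  assumes uv: "\<And>x t. t \<in> {0<..<1} \<Longrightarrow> u x t = v x t"
    and u: "feasible \<epsilon> f B \<rho>0 \<rho>1 \<rho> u"
  shows "feasible \<epsilon> f B \<rho>0 \<rho>1 \<rho> v"
proof -
  have "(\<lambda>z. indicator (UNIV \<times> {0<..<1}) z *\<^sub>R (case z of (x, t) \<Rightarrow> u x t))
      = (\<lambda>z. indicator (UNIV \<times> {0<..<1}) z *\<^sub>R (case z of (x, t) \<Rightarrow> v x t))"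
    using uv by (auto simp: fun_eq_iff indicator_def)
  moreover have "energy \<rho> u = energy \<rho> v"
    using uv by (rule energy_cong)
  ultimately have "finite_energy \<rho> v"
    using u
    unfolding feasible_def finite_energy_def set_borel_measurable_def by simp
  moreover have "controlled_FPK \<epsilon> f B \<rho> v"
    using u uv unfolding feasible_def controlled_FPK_def space_diff_def by simp
  ultimately show ?thesis
    using u unfolding feasible_def by blast
qed

lemma solves_steering_cong:
  fixes u v :: "real^'n \<Rightarrow> real \<Rightarrow> real^'m"
  assumes "\<And>x t. t \<in> {0<..<1} \<Longrightarrow> u x t = v x t"
    and "solves_steering \<epsilon> f B \<rho>0 \<rho>1 \<rho> u"
  shows "solves_steering \<epsilon> f B \<rho>0 \<rho>1 \<rho> v"
proof -
  have "energy \<rho> u = energy \<rho> v"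
    using assms(1) by (rule energy_cong)
  moreover have "feasible \<epsilon> f B \<rho>0 \<rho>1 \<rho> v"
    using assms(1) assms(2)[unfolded solves_steering_def, THEN conjunct1] by (rule feasible_cong)
  ultimately show ?thesis
    using assms(2) unfolding solves_steering_def cost_def by simp
qed

section \<open>Linearization of the optimality system\<close>

theorem theorem2:
  fixes \<epsilon> :: real
    and f :: "real^'n \<Rightarrow> real \<Rightarrow> real^'n"
    and B :: "real \<Rightarrow> real^'m^'n"
    and \<rho>0 \<rho>1 :: "real^'n \<Rightarrow> real"
    and \<rho>opt \<psi> \<phi> \<phi>h :: "real^'n \<Rightarrow> real \<Rightarrow> real"
    and uopt :: "real^'n \<Rightarrow> real \<Rightarrow> real^'m"
  assumes "\<epsilon> > 0"
    and "growth_lipschitz f B"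
    and "uniformly_elliptic B"
    and "is_pdf \<rho>0" and "is_pdf \<rho>1"
    and "solves_steering \<epsilon> f B \<rho>0 \<rho>1 \<rho>opt uopt"
    and "\<And>x t. t \<in> {0<..<1} \<Longrightarrow> uopt x t = transpose (B t) *v grad (\<lambda>y. \<psi> y t) x"
    and "diff_1_2 \<psi>"
    and "diff_1_2 \<rho>opt"
    and "space_diff (\<lambda>x t. \<rho>opt x t *\<^sub>R
           (f x t + (B t ** transpose (B t)) *v grad (\<lambda>y. \<psi> y t) x))"
    and "\<And>x t. t \<in> {0<..<1} \<Longrightarrow>
           deriv (\<lambda>s. \<psi> x s) t
             + 1/2 * (norm (transpose (B t) *v grad (\<lambda>y. \<psi> y t) x))\<^sup>2
             + grad (\<lambda>y. \<psi> y t) x \<bullet> f x t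
           = - \<epsilon> * frob (diffusion B t) (hess (\<lambda>y. \<psi> y t) x)"
    and "\<And>x t. t \<in> {0<..<1} \<Longrightarrow>
           deriv (\<lambda>s. \<rho>opt x s) t
             + divg (\<lambda>y. \<rho>opt y t *\<^sub>R
                 (f y t + (B t ** transpose (B t)) *v grad (\<lambda>z. \<psi> z t) y)) x
           = \<epsilon> * frob (diffusion B t) (hess (\<lambda>y. \<rho>opt y t) x)"
    and "\<And>x. \<rho>opt x 0 = \<rho>0 x"
    and "\<And>x. \<rho>opt x 1 = \<rho>1 x"
    and "\<And>x t. \<phi> x t = exp (\<psi> x t / (2 * \<epsilon>))"
    and "\<And>x t. \<phi>h x t = \<rho>opt x t * exp (- \<psi> x t / (2 * \<epsilon>))"
  shows "(diff_1_2 \<phi> \<and> diff_1_2 \<phi>h \<and> space_diff (\<lambda>x t. \<phi>h x t *\<^sub>R f x t)) \<and>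
    (\<forall>x. \<forall>t\<in>{0<..<1}.
       deriv (\<lambda>s. \<phi> x s) t
       = - (grad (\<lambda>y. \<phi> y t) x \<bullet> f x t)
         - \<epsilon> * frob (diffusion B t) (hess (\<lambda>y. \<phi> y t) x)) \<and>
    (\<forall>x. \<forall>t\<in>{0<..<1}.
       deriv (\<lambda>s. \<phi>h x s) t
       = - divg (\<lambda>y. \<phi>h y t *\<^sub>R f y t) x
         + \<epsilon> * frob (diffusion B t) (hess (\<lambda>y. \<phi>h y t) x)) \<and>
    (\<forall>x. \<phi> x 0 * \<phi>h x 0 = \<rho>0 x) \<and>
    (\<forall>x. \<phi> x 1 * \<phi>h x 1 = \<rho>1 x) \<and>
    (\<forall>x. \<forall>t\<in>{0..1}. \<rho>opt x t = \<phi> x t * \<phi>h x t) \<and>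
    (\<forall>x. \<forall>t\<in>{0<..<1}.
       (\<lambda>y. ln (\<phi> y t)) differentiable (at x) \<and>
       uopt x t = (2 * \<epsilon>) *\<^sub>R (transpose (B t) *v grad (\<lambda>y. ln (\<phi> y t)) x)) \<and>
    solves_steering \<epsilon> f B \<rho>0 \<rho>1
      (\<lambda>x t. \<phi> x t * \<phi>h x t)
      (\<lambda>x t. (2 * \<epsilon>) *\<^sub>R (transpose (B t) *v grad (\<lambda>y. ln (\<phi> y t)) x))"
proof -
  note \<epsilon> = assms(1) and opt = assms(6) and uopt = assms(7) and \<psi> = assms(8) and \<rho> = assms(9)
    and flux = assms(10) and hjb = assms(11) and fpk = assms(12)
    and init = assms(13) and final = assms(14)
  define k where "k = 1 / (2 * \<epsilon>)"
  have \<phi>: "\<phi> = (\<lambda>x t. exp (k * \<psi> x t))"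
    using assms(15) by (simp add: fun_eq_iff k_def)
  have \<phi>h: "\<phi>h = (\<lambda>x t. \<rho>opt x t * exp (- k * \<psi> x t))"
    using assms(16) by (simp add: fun_eq_iff k_def)
  have prod: "\<phi> x t * \<phi>h x t = \<rho>opt x t" for x t
    by (simp add: \<phi> \<phi>h exp_minus)
  have flux': "(\<lambda>y. \<rho>opt y t *\<^sub>R (f y t + diffusion B t *v grad (\<lambda>z. \<psi> z t) y))
      differentiable (at x)" if "t \<in> {0<..<1}" for x t
    using flux that unfolding space_diff_def diffusion_def by blast
  have d\<phi>: "diff_1_2 \<phi>"
    unfolding \<phi> using \<psi> by (rule diff_1_2_exp)
  have d\<phi>h: "diff_1_2 \<phi>h"
    unfolding \<phi>h using \<rho> diff_1_2_exp[OF \<psi>] by (rule diff_1_2_mult)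
  have sd: "space_diff (\<lambda>x t. \<phi>h x t *\<^sub>R f x t)"
    unfolding space_diff_def
  proof (intro allI ballI)
    fix x and t :: real assume t: "t \<in> {0<..<1}"
    have "(\<lambda>y. \<rho>opt y t *\<^sub>R f y t) differentiable (at x)"
      using differentiable_drift_flux[OF _ _ flux'[OF t]] \<rho> \<psi> t unfolding diff_1_2_def by blast
    moreover have "(\<lambda>y. exp (- k * \<psi> y t)) differentiable (at x)"
      using diff_1_2_exp[OF \<psi>, of "- k"] t unfolding diff_1_2_def by blast
    ultimately have "(\<lambda>y. exp (- k * \<psi> y t) *\<^sub>R (\<rho>opt y t *\<^sub>R f y t)) differentiable (at x)"
      by (rule differentiable_scaleR[rotated])
    then show "(\<lambda>y. \<phi>h y t *\<^sub>R f y t) differentiable (at x)"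
      by (simp add: \<phi>h mult.commute)
  qed
  have backward: "deriv (\<lambda>s. \<phi> x s) t = - (grad (\<lambda>y. \<phi> y t) x \<bullet> f x t)
      - \<epsilon> * frob (diffusion B t) (hess (\<lambda>y. \<phi> y t) x)" if t: "t \<in> {0<..<1}" for x t
    unfolding \<phi> by (rule hopf_cole_backward[OF \<epsilon> k_def \<psi> t hjb[OF t]])
  have forward: "deriv (\<lambda>s. \<phi>h x s) t = - divg (\<lambda>y. \<phi>h y t *\<^sub>R f y t) x
      + \<epsilon> * frob (diffusion B t) (hess (\<lambda>y. \<phi>h y t) x)" if t: "t \<in> {0<..<1}" for x t
    unfolding \<phi>h
    by (rule hopf_cole_forward[where x = x and f = f and \<rho> = \<rho>opt,
          OF \<epsilon> k_def \<psi> \<rho> t flux'[OF t] hjb[OF t]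
          fpk[OF t, folded diffusion_def]])
  have ln: "GDERIV (\<lambda>y. ln (\<phi> y t)) x :> k *\<^sub>R grad (\<lambda>y. \<psi> y t) x" if t: "t \<in> {0<..<1}" for x t
  proof -
    have "GDERIV (\<lambda>y. \<psi> y t) x :> grad (\<lambda>y. \<psi> y t) x"
      using \<psi> t GDERIV_grad unfolding diff_1_2_def by blast
    from GDERIV_mult[OF GDERIV_const[of k] this] show ?thesis
      by (simp add: \<phi>)
  qed
  have control: "uopt x t = (2 * \<epsilon>) *\<^sub>R (transpose (B t) *v grad (\<lambda>y. ln (\<phi> y t)) x)"
    if t: "t \<in> {0<..<1}" for x t
    using \<epsilon> uopt[OF t] by (simp add: grad_eqI[OF ln[OF t]] matrix_vector_mult_scaleR k_def)
  have "solves_steering \<epsilon> f B \<rho>0 \<rho>1 \<rho>opt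
      (\<lambda>x t. (2 * \<epsilon>) *\<^sub>R (transpose (B t) *v grad (\<lambda>y. ln (\<phi> y t)) x))"
    using control opt by (rule solves_steering_cong)
  then show ?thesis
    unfolding prod
    using d\<phi> d\<phi>h sd backward forward init final control GDERIV_imp_differentiable[OF ln]
    by blast
qed

end
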